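(* Let $x[0]\le\cdots\le x[n-1]$ and $y[0]\le\cdots\le y[n-1]$ be real numbers. Algorithm 1 (described in the context) returns a list containing every sum $x[i]+y[j]$, $0\le i,j\le n-1$, exactly once (as a multiset of $n^2$ entries), arranged in non-decreasing order.
   Context: Algorithm 1 (sumset sorting). Input: arrays $x[0..n-1]$, $y[0..n-1]$ sorted in non-decreasing order. Initialize an empty list $Z$ (0-indexed), set $\mathrm{low}[i]\leftarrow x[i]+y[0]$ for each $i$, and $ip\leftarrow 0$. For $i=0,\dots,n-1$ (row $i$): set $cp\leftarrow ip$; then for $j=0,\dots,n-1$: let $sum\leftarrow x[i]+y[j]$; while $cp<|Z|$ and $Z[cp]\le sum$, set $cp\leftarrow cp+1$; insert $sum$ into $Z$ at position $cp$ (shifting later elements one position to the right); if $i+1<n$ and $sum\le \mathrm{low}[i+1]$, set $ip\leftarrow cp$. Finally return $Z$. *)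

theory Defs
  imports Complex_Main "HOL-Library.Multiset" "HOL-Library.While_Combinator"
begin

definition insert_at :: "nat \<Rightarrow> 'a \<Rightarrow> 'a list \<Rightarrow> 'a list" where
  "insert_at p a Z = take p Z @ a # drop p Z"

definition advance :: "real list \<Rightarrow> real \<Rightarrow> nat \<Rightarrow> nat" where
  "advance Z s cp = while (\<lambda>cp. cp < length Z \<and> Z ! cp \<le> s) (\<lambda>cp. cp + 1) cp"

text \<open>The state of the inner loop is \<open>(Z, ip, cp)\<close>.\<close>

definition inner_step ::
  "nat \<Rightarrow> real list \<Rightarrow> real list \<Rightarrow> real list \<Rightarrow> nat \<Rightarrow> nat \<Rightarrow>
    real list \<times> nat \<times> nat \<Rightarrow> real list \<times> nat \<times> nat" where
  "inner_step n x y low i j = (\<lambda>(Z, ip, cp).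
     let s = x ! i + y ! j;
         cp' = advance Z s cp;
         Z' = insert_at cp' s Z;
         ip' = (if i + 1 < n \<and> s \<le> low ! (i + 1) then cp' else ip)
     in (Z', ip', cp'))"

text \<open>The state of the outer loop is \<open>(Z, ip)\<close>; \<open>cp\<close> is reset to \<open>ip\<close> at the start of each row.\<close>

definition row_step ::
  "nat \<Rightarrow> real list \<Rightarrow> real list \<Rightarrow> real list \<Rightarrow> nat \<Rightarrow>
    real list \<times> nat \<Rightarrow> real list \<times> nat" where
  "row_step n x y low i = (\<lambda>(Z, ip).
     let (Z', ip', cp') = fold (inner_step n x y low i) [0..<n] (Z, ip, ip)
     in (Z', ip'))"

definition sumset_sort :: "nat \<Rightarrow> real list \<Rightarrow> real list \<Rightarrow> real list" where
  "sumset_sort n x y =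
     (let low = map (\<lambda>i. x ! i + y ! 0) [0..<n];
          (Z, ip) = fold (row_step n x y low) [0..<n] ([], 0)
      in Z)"

end

theory Submission
  imports Defs
begin

text \<open>Both pointers only ever skip entries that are harmless: everything in front of \<open>cp\<close> is at most
  the next sum of the current row, and everything in front of \<open>ip\<close> is at most the first sum of
  the next row. Every insertion happens at or behind both pointers, so it disturbs neither prefix,
  and its position separates the entries that are at most \<open>sum\<close> from the larger ones.\<close>

definition prefix_le :: "nat \<Rightarrow> 'a::linorder list \<Rightarrow> 'a \<Rightarrow> bool" where
  "prefix_le p Z s \<longleftrightarrow> p \<le> length Z \<and> (\<forall>a \<in> set (take p Z). a \<le> s)"

lemma prefix_le_0 [simp]: "prefix_le 0 Z s"
  by (simp add: prefix_le_def)

lemma prefix_le_mono: "prefix_le p Z s \<Longrightarrow> s \<le> t \<Longrightarrow> prefix_le p Z t"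
  by (auto simp: prefix_le_def)

lemma prefix_le_Suc: "prefix_le p Z s \<Longrightarrow> p < length Z \<Longrightarrow> Z ! p \<le> s \<Longrightarrow> prefix_le (Suc p) Z s"
  by (auto simp: prefix_le_def take_Suc_conv_app_nth)

lemma mset_insert_at [simp]: "mset (insert_at p a Z) = add_mset a (mset Z)"
proof -
  have "mset (insert_at p a Z) = add_mset a (mset (take p Z @ drop p Z))"
    unfolding insert_at_def by (simp del: append_take_drop_id)
  then show ?thesis by simp
qed

lemma prefix_le_insert_at:
  "prefix_le p Z s \<Longrightarrow> p \<le> q \<Longrightarrow> q \<le> length Z \<Longrightarrow> prefix_le p (insert_at q a Z) s"
  by (simp add: prefix_le_def insert_at_def min_def)

lemma sorted_insert_at:
  assumes "sorted Z" and "prefix_le p Z s" and "p < length Z \<Longrightarrow> s \<le> Z ! p"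
  shows "sorted (insert_at p s Z)"
proof -
  have "\<forall>b \<in> set (drop p Z). s \<le> b"
  proof (cases "p < length Z")
    case True
    then have "drop p Z = Z ! p # drop (Suc p) Z"
      by (simp add: Cons_nth_drop_Suc)
    moreover have "sorted (drop p Z)"
      using \<open>sorted Z\<close> by (rule sorted_wrt_drop)
    ultimately show ?thesis
      using assms(3)[OF True] by auto
  qed simp
  moreover have "sorted (take p Z @ drop p Z)"
    using \<open>sorted Z\<close> by simp
  ultimately show ?thesis
    using \<open>prefix_le p Z s\<close> unfolding insert_at_def sorted_append
    by (auto simp: prefix_le_def)
qed

lemma
  assumes "prefix_le p Z s"
  shows advance_ge: "p \<le> advance Z s p"
    and prefix_le_advance: "prefix_le (advance Z s p) Z s"
    and less_nth_advance: "advance Z s p < length Z \<Longrightarrow> s < Z ! advance Z s p"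
proof -
  have "p \<le> advance Z s p \<and> prefix_le (advance Z s p) Z s \<and>
    (advance Z s p < length Z \<longrightarrow> s < Z ! advance Z s p)"
    unfolding advance_def
    by (rule while_rule[where P = "\<lambda>q. p \<le> q \<and> prefix_le q Z s"
          and r = "measure (\<lambda>q. length Z - q)"])
      (use assms in \<open>auto intro: prefix_le_Suc\<close>)
  then show "p \<le> advance Z s p" and "prefix_le (advance Z s p) Z s"
    and "advance Z s p < length Z \<Longrightarrow> s < Z ! advance Z s p"
    by auto
qed

lemma sorted_insert_at_advance:
  "sorted Z \<Longrightarrow> prefix_le p Z s \<Longrightarrow> sorted (insert_at (advance Z s p) s Z)"
  by (simp add: sorted_insert_at prefix_le_advance less_nth_advance less_imp_le)

lemma fold_upt_invariant:
  assumes "m \<le> n" and "P m s"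
    and "\<And>k t. m \<le> k \<Longrightarrow> k < n \<Longrightarrow> P k t \<Longrightarrow> P (Suc k) (f k t)"
  shows "P n (fold f [m..<n] s)"
  using \<open>m \<le> n\<close>
proof (induction n rule: dec_induct)
  case base
  show ?case using \<open>P m s\<close> by simp
next
  case (step k)
  then show ?case using assms(3) by simp
qed

lemma mset_set_insert_Times:
  assumes "finite A" and "finite B" and "a \<notin> A"
  shows "mset_set (insert a A \<times> B) = mset_set (A \<times> B) + image_mset (Pair a) (mset_set B)"
proof -
  have "insert a A \<times> B = A \<times> B \<union> Pair a ` B"
    by auto
  moreover have "A \<times> B \<inter> Pair a ` B = {}"
    using \<open>a \<notin> A\<close> by auto
  ultimately show ?thesis
    using assms by (simp add: mset_set_Union image_mset_mset_set inj_on_def)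
qed

fun inner_invariant ::
  "nat \<Rightarrow> real list \<Rightarrow> real list \<Rightarrow> real list \<Rightarrow> nat \<Rightarrow> real multiset \<Rightarrow> nat \<Rightarrow>
    real list \<times> nat \<times> nat \<Rightarrow> bool" where
  "inner_invariant n x y low i earlier j (Z, ip, cp) \<longleftrightarrow>
     sorted Z \<and> mset Z = earlier + {# x ! i + y ! k. k \<in># mset_set {0..<j} #} \<and> ip \<le> cp \<and>
     (j < n \<longrightarrow> prefix_le cp Z (x ! i + y ! j)) \<and>
     (i + 1 < n \<longrightarrow> prefix_le ip Z (low ! (i + 1)))"

fun row_invariant ::
  "nat \<Rightarrow> real list \<Rightarrow> real list \<Rightarrow> real list \<Rightarrow> nat \<Rightarrow> real list \<times> nat \<Rightarrow> bool" where
  "row_invariant n x y low i (Z, ip) \<longleftrightarrow>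
     sorted Z \<and> mset Z = {# x ! k + y ! l. (k, l) \<in># mset_set ({0..<i} \<times> {0..<n}) #} \<and>
     (i < n \<longrightarrow> prefix_le ip Z (low ! i))"

lemma inner_invariant_inner_step:
  assumes "length y = n" and "sorted y" and "j < n"
    and invariant: "inner_invariant n x y low i earlier j \<sigma>"
  shows "inner_invariant n x y low i earlier (Suc j) (inner_step n x y low i j \<sigma>)"
proof -
  obtain Z ip cp where \<sigma>: "\<sigma> = (Z, ip, cp)"
    by (cases \<sigma>)
  define s where "s = x ! i + y ! j"
  define q where "q = advance Z s cp"
  define ip' where "ip' = (if i + 1 < n \<and> s \<le> low ! (i + 1) then q else ip)"
  have step: "inner_step n x y low i j \<sigma> = (insert_at q s Z, ip', q)"
    by (simp add: inner_step_def \<sigma> s_def q_def ip'_def Let_def)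
  have prefix_cp: "prefix_le cp Z s" and "ip \<le> cp" and "sorted Z"
    using invariant \<open>j < n\<close> by (auto simp: \<sigma> s_def)
  have "cp \<le> q" and prefix_q: "prefix_le q Z s"
    using advance_ge prefix_le_advance prefix_cp by (simp_all add: q_def)
  have "q \<le> length Z"
    using prefix_q by (simp add: prefix_le_def)
  have "sorted (insert_at q s Z)"
    using \<open>sorted Z\<close> prefix_cp by (simp add: q_def sorted_insert_at_advance)
  moreover have "mset (insert_at q s Z) = earlier + {# x ! i + y ! k. k \<in># mset_set {0..<Suc j} #}"
    using invariant by (simp add: \<sigma> s_def atLeast0_lessThan_Suc)
  moreover have "ip' \<le> q"
    using \<open>ip \<le> cp\<close> \<open>cp \<le> q\<close> by (simp add: ip'_def)
  moreover have "prefix_le q (insert_at q s Z) (x ! i + y ! Suc j)" if "Suc j < n"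
  proof -
    have "s \<le> x ! i + y ! Suc j"
      using assms(1,2) that by (simp add: s_def sorted_nth_mono)
    with prefix_q show ?thesis
      using \<open>q \<le> length Z\<close> by (auto intro: prefix_le_insert_at prefix_le_mono)
  qed
  moreover have "prefix_le ip' (insert_at q s Z) (low ! (i + 1))" if "i + 1 < n"
  proof -
    have "prefix_le ip' Z (low ! (i + 1))"
      using invariant prefix_q that by (auto simp: \<sigma> ip'_def intro: prefix_le_mono)
    then show ?thesis
      using \<open>ip' \<le> q\<close> \<open>q \<le> length Z\<close> by (rule prefix_le_insert_at)
  qed
  ultimately show ?thesis
    by (simp add: step)
qed

lemma row_invariant_row_step:
  assumes "length y = n" and "sorted y" and "length low = n" and "sorted low"
    and "i < n" and low_i: "low ! i = x ! i + y ! 0"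
    and invariant: "row_invariant n x y low i \<sigma>"
  shows "row_invariant n x y low (Suc i) (row_step n x y low i \<sigma>)"
proof -
  obtain Z ip where \<sigma>: "\<sigma> = (Z, ip)"
    by (cases \<sigma>)
  obtain Z' ip' cp' where run: "fold (inner_step n x y low i) [0..<n] (Z, ip, ip) = (Z', ip', cp')"
    by (metis prod_cases3)
  have "prefix_le ip Z (low ! (i + 1))" if "i + 1 < n"
  proof -
    have "low ! i \<le> low ! (i + 1)"
      using \<open>sorted low\<close> \<open>length low = n\<close> that by (simp add: sorted_nth_mono)
    with invariant \<open>i < n\<close> show ?thesis
      by (auto simp: \<sigma> intro: prefix_le_mono)
  qed
  then have "inner_invariant n x y low i (mset Z) 0 (Z, ip, ip)"
    using invariant \<open>i < n\<close> by (simp add: \<sigma> low_i)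
  then have "inner_invariant n x y low i (mset Z) n
      (fold (inner_step n x y low i) [0..<n] (Z, ip, ip))"
    using inner_invariant_inner_step[OF assms(1,2)]
    by (intro fold_upt_invariant[where P = "inner_invariant n x y low i (mset Z)"]) simp_all
  moreover have "row_step n x y low i \<sigma> = (Z', ip')"
    by (simp add: row_step_def \<sigma> run)
  ultimately show ?thesis
    using invariant
    by (simp add: \<sigma> run atLeast0_lessThan_Suc mset_set_insert_Times
        image_mset.compositionality comp_def)
qed

theorem mainTheorem10:
  fixes n :: nat and x y :: "real list"
  assumes "length x = n" and "length y = n"
    and "sorted x" and "sorted y"
  shows "mset (sumset_sort n x y) =
           {# x ! i + y ! j. (i, j) \<in># mset_set ({0..<n} \<times> {0..<n}) #}
       \<and> length (sumset_sort n x y) = n ^ 2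
       \<and> sorted (sumset_sort n x y)"
proof -
  define low where "low = map (\<lambda>i. x ! i + y ! 0) [0..<n]"
  obtain Z ip where run: "fold (row_step n x y low) [0..<n] ([], 0) = (Z, ip)"
    by (metis surj_pair)
  have low_nth: "low ! i = x ! i + y ! 0" if "i < n" for i
    using that by (simp add: low_def)
  have "length low = n" and "sorted low"
    using \<open>length x = n\<close> \<open>sorted x\<close> by (auto simp: low_def sorted_iff_nth_mono)
  then have "row_invariant n x y low n (fold (row_step n x y low) [0..<n] ([], 0))"
    using row_invariant_row_step[OF assms(2,4)] low_nth
    by (intro fold_upt_invariant[where P = "row_invariant n x y low"]) simp_all
  then have sums: "mset Z = {# x ! i + y ! j. (i, j) \<in># mset_set ({0..<n} \<times> {0..<n}) #}"
    and "sorted Z"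
    by (auto simp: run)
  moreover have "length Z = n ^ 2"
    using arg_cong[OF sums, of size] by (simp add: power2_eq_square)
  moreover have "sumset_sort n x y = Z"
    using run by (simp add: sumset_sort_def low_def)
  ultimately show ?thesis by simp
qed

end
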